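(* Let $R$ be a subdirectly irreducible BL-ring with minimal ideal $M$. Then: 1. the annihilator ideals of $R$ are linearly ordered (by inclusion) and finite in number; 2. every ideal of $R$ is either an annihilator ideal or dense; 3. $M$ is an annihilator ideal; 4. for every annihilator ideal $I\neq R$ and every dense ideal $J$ of $R$, $I\subseteq J$ and $J\to I=I$; 5. for all ideals $I,J$ of $R$, either $I\to J$ or $J\to I$ is dense.
   Context: Rings are commutative and are not assumed to have an identity. For ideals $I,J$ of a ring $R$, $I\cdot J$ is the usual product ideal, $I\to J:=\{x\in R: xI\subseteq J\}$, and $I^\ast:=I\to 0$ is the annihilator of $I$ in $R$. A commutative ring $R$ is called a BL-ring if for all ideals $I,J$ of $R$: (BLR-1) $I\cap J=I\cdot(I\to J)$, and (BLR-2) $(I\to J)+(J\to I)=R$. An ideal $I$ of $R$ is an annihilator ideal if $I=J^\ast$ for some ideal $J$ of $R$, and is dense if $I^\ast=0$. A (nonzero) ring is subdirectly irreducible if it has a smallest nonzero ideal, i.e. a nonzero ideal contained in every nonzero ideal; this ideal is its minimal ideal $M$. *)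

theory Defs
  imports Complex_Main "HOL-Library.Set_Algebras"
begin

text \<open>A ring is a type of class \<^class>\<open>comm_ring\<close>, which does not require a unit; the ring
  itself, as an ideal, is \<^term>\<open>UNIV\<close>.\<close>

definition ring_ideal :: "'a::comm_ring set \<Rightarrow> bool" where
  "ring_ideal I \<longleftrightarrow>
     0 \<in> I \<and> (\<forall>x\<in>I. \<forall>y\<in>I. x - y \<in> I) \<and> (\<forall>r. \<forall>x\<in>I. r * x \<in> I)"

definition ideal_mult :: "'a::comm_ring set \<Rightarrow> 'a set \<Rightarrow> 'a set" (infixl "\<cdot>\<^sub>i" 70) where
  "I \<cdot>\<^sub>i J = {\<Sum>k<n. x k * y k | (n::nat) x y. \<forall>k<n. x k \<in> I \<and> y k \<in> J}"

definition ideal_residual :: "'a::comm_ring set \<Rightarrow> 'a set \<Rightarrow> 'a set" (infixr "\<rightarrow>\<^sub>i" 68) where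
  "I \<rightarrow>\<^sub>i J = {x. \<forall>y\<in>I. x * y \<in> J}"

definition ideal_ann :: "'a::comm_ring set \<Rightarrow> 'a set" where
  "ideal_ann I = I \<rightarrow>\<^sub>i {0}"

text \<open>The sum of ideals is the elementwise sum of sets from \<^theory>\<open>HOL-Library.Set_Algebras\<close>.\<close>

definition BL_ring :: "'a::comm_ring itself \<Rightarrow> bool" where
  "BL_ring _ \<longleftrightarrow>
     (\<forall>I J :: 'a set. ring_ideal I \<longrightarrow> ring_ideal J \<longrightarrow>
        I \<inter> J = I \<cdot>\<^sub>i (I \<rightarrow>\<^sub>i J) \<and> (I \<rightarrow>\<^sub>i J) + (J \<rightarrow>\<^sub>i I) = UNIV)"

definition annihilator_ideal :: "'a::comm_ring set \<Rightarrow> bool" where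
  "annihilator_ideal I \<longleftrightarrow> ring_ideal I \<and> (\<exists>J. ring_ideal J \<and> I = ideal_ann J)"

definition dense_ideal :: "'a::comm_ring set \<Rightarrow> bool" where
  "dense_ideal I \<longleftrightarrow> ring_ideal I \<and> ideal_ann I = {0}"

text \<open>The minimal ideal of a subdirectly irreducible ring: the least nonzero ideal, contained in
  all nonzero ideals, not merely an ideal that is minimal among them.\<close>

definition minimal_ideal :: "'a::comm_ring set \<Rightarrow> bool" where
  "minimal_ideal M \<longleftrightarrow>
     ring_ideal M \<and> M \<noteq> {0} \<and> (\<forall>I. ring_ideal I \<longrightarrow> I \<noteq> {0} \<longrightarrow> M \<subseteq> I)"

definition subdirectly_irreducible :: "'a::comm_ring itself \<Rightarrow> bool" where
  "subdirectly_irreducible _ \<longleftrightarrow> (\<exists>M :: 'a set. minimal_ideal M)"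

end

theory Submission
  imports Defs
begin

text \<open>
  The ring \<open>R\<close> has very few ideals: they form a finite chain, every one of them is an annihilator
  ideal, and \<open>R\<close> is the only dense one. All five claims are then immediate. In the fifth, for
  instance, \<open>I \<subseteq> J\<close> or \<open>J \<subseteq> I\<close>, so that one of the two residuals is \<open>R\<close>.

  Put \<open>P = M\<^sup>*\<close>. An element outside \<open>P\<close> is not a zero divisor, because \<open>M \<subseteq> xR\<close> for
  every \<open>x \<noteq> 0\<close>; and \<open>R = sR + P\<close> for every \<open>s\<close>
  outside \<open>P\<close>, because \<open>M\<close> is a simple module and is generated by any of its nonzero elements.
  Consider the ascending series \<open>A\<^sub>0 = 0\<close>, \<open>A\<^bsub>k+1\<^esub> = P \<rightarrow> A\<^sub>k\<close>, so that \<open>A\<^sub>k\<close> is the annihilator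
  of \<open>P\<^sup>k\<close>. The key point is that the series reaches \<open>R\<close>, that is, that \<open>P\<close> is nilpotent.
  The union \<open>T\<close> of the series is not contained in \<open>P\<close>: otherwise (BLR-1) gives
  \<open>A\<^sub>k = P \<inter> A\<^sub>k = P \<cdot> A\<^bsub>k+1\<^esub>\<close>, hence \<open>T = P \<cdot> T\<close>; as also \<open>M = T \<cdot> (T \<rightarrow> M)\<close> by (BLR-1), this
  yields \<open>M = P \<cdot> T \<cdot> (T \<rightarrow> M) \<subseteq> P \<cdot> M = 0\<close>, which is absurd
  (lemma \<open>series_escapes\<close>). So some \<open>A\<^sub>n\<close> contains a non-zero-divisor, and then \<open>A\<^sub>n = R\<close>
  (lemma \<open>series_reaches_UNIV\<close>).

  It follows that an ideal not contained in \<open>P\<close> is \<open>R\<close> (lemma \<open>ideal_eq_UNIV\<close>), and then that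
  every ideal \<open>I\<close> is a member of the series (lemma \<open>ideal_in_series\<close>): if \<open>A\<close> is the first
  member that contains \<open>I\<close>, then \<open>I = A \<cdot> (A \<rightarrow> I)\<close>, and either \<open>A \<rightarrow> I \<subseteq> P\<close>, which would put
  \<open>I\<close> into the preceding member, or \<open>A \<rightarrow> I = R\<close> and so \<open>I = A\<close>. Finally every member of the
  series equals its double annihilator (lemma \<open>series_double_ann\<close>).
\<close>

section \<open>Ideals, products and residuals\<close>

lemma ring_idealD:
  assumes "ring_ideal I"
  shows ring_ideal_0: "0 \<in> I"
    and ring_ideal_diff: "x \<in> I \<Longrightarrow> y \<in> I \<Longrightarrow> x - y \<in> I"
    and ring_ideal_mult: "x \<in> I \<Longrightarrow> r * x \<in> I"
    and ring_ideal_mult': "x \<in> I \<Longrightarrow> x * r \<in> I"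
  using assms by (auto simp: ring_ideal_def mult.commute[of _ r])

lemma ring_ideal_add:
  assumes "ring_ideal I" "x \<in> I" "y \<in> I"
  shows "x + y \<in> I"
  using ring_ideal_diff[OF assms(1,2), of "0 - y"] ring_idealD(1,2)[OF assms(1)] assms(3)
  by fastforce

lemma ring_ideal_sum:
  assumes "ring_ideal I" "\<And>k. k \<in> S \<Longrightarrow> f k \<in> I"
  shows "sum f S \<in> I"
  using assms(2) by (induction S rule: infinite_finite_induct)
    (auto intro: ring_ideal_add[OF assms(1)] ring_ideal_0[OF assms(1)])

lemma ring_ideal_zero: "ring_ideal {0}"
  by (auto simp: ring_ideal_def)

lemma ring_ideal_UNIV: "ring_ideal UNIV"
  by (auto simp: ring_ideal_def)

lemma ring_ideal_multiples: "ring_ideal (range ((*) x))"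
proof -
  have "x * a - x * b \<in> range ((*) x)" for a b
    by (metis rangeI right_diff_distrib)
  moreover have "r * (x * a) \<in> range ((*) x)" for r a
    by (metis rangeI mult.left_commute)
  moreover have "0 \<in> range ((*) x)"
    by (metis rangeI mult_zero_right)
  ultimately show ?thesis
    by (auto simp: ring_ideal_def)
qed

lemma ring_ideal_residual:
  assumes "ring_ideal J"
  shows "ring_ideal (I \<rightarrow>\<^sub>i J)"
  using ring_idealD[OF assms]
  by (auto simp: ring_ideal_def ideal_residual_def left_diff_distrib mult.assoc)

lemma ring_ideal_ann: "ring_ideal (ideal_ann I)"
  unfolding ideal_ann_def by (rule ring_ideal_residual[OF ring_ideal_zero])

lemma ideal_ann_iff: "x \<in> ideal_ann I \<longleftrightarrow> (\<forall>y\<in>I. x * y = 0)"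
  by (auto simp: ideal_ann_def ideal_residual_def)

lemma subset_double_ann: "I \<subseteq> ideal_ann (ideal_ann I)"
proof
  fix x assume "x \<in> I"
  then have "y * x = 0" if "y \<in> ideal_ann I" for y
    using that by (simp add: ideal_ann_iff)
  then show "x \<in> ideal_ann (ideal_ann I)"
    by (simp add: ideal_ann_iff mult.commute[of x])
qed

lemma ideal_mult_least:
  assumes "ring_ideal K" "\<And>x y. x \<in> I \<Longrightarrow> y \<in> J \<Longrightarrow> x * y \<in> K"
  shows "I \<cdot>\<^sub>i J \<subseteq> K"
  using assms by (auto simp: ideal_mult_def intro!: ring_ideal_sum)

lemma residual_eq_UNIV:
  assumes "ring_ideal J" "I \<subseteq> J"
  shows "I \<rightarrow>\<^sub>i J = UNIV"
  using assms by (auto simp: ideal_residual_def intro: ring_ideal_mult)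

section \<open>The annihilator of the minimal ideal\<close>

locale minimal_ideal_BL =
  fixes M :: "'a::comm_ring set"
  assumes minimal: "minimal_ideal M"
    and inter_eq_mult: "\<And>I J :: 'a set. ring_ideal I \<Longrightarrow> ring_ideal J \<Longrightarrow> I \<inter> J = I \<cdot>\<^sub>i (I \<rightarrow>\<^sub>i J)"
begin

text \<open>The form in which (BLR-1) is used throughout: since \<open>I = J \<cdot> (J \<rightarrow> I)\<close>, it suffices to test
  products.\<close>

lemma subideal_least:
  fixes I J K :: "'a set"
  assumes "ring_ideal I" "ring_ideal J" "I \<subseteq> J" "ring_ideal K"
    and "\<And>y z. y \<in> J \<Longrightarrow> z \<in> J \<rightarrow>\<^sub>i I \<Longrightarrow> y * z \<in> K"
  shows "I \<subseteq> K"
  using inter_eq_mult[OF assms(2,1)] ideal_mult_least[OF assms(4,5), of J "J \<rightarrow>\<^sub>i I"] assms(3)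
  by blast

text \<open>The case \<open>J = I\<close> says \<open>I = I \<cdot> R\<close>, which stands in for a unit of the ring.\<close>

lemma ideal_least:
  fixes I K :: "'a set"
  assumes "ring_ideal I" "ring_ideal K" "\<And>y z. y \<in> I \<Longrightarrow> y * z \<in> K"
  shows "I \<subseteq> K"
  using subideal_least[OF assms(1) assms(1) subset_refl assms(2)] assms(3) by blast

lemma ann_UNIV: "ideal_ann (UNIV :: 'a set) = {0}"
  using ideal_least[OF ring_ideal_ann ring_ideal_zero, of UNIV]
    ring_ideal_0[OF ring_ideal_ann, of UNIV]
  by (auto simp: ideal_ann_iff)

lemma M_ideal: "ring_ideal M"
  and M_nonzero: "M \<noteq> {0}"
  and M_least: "ring_ideal I \<Longrightarrow> I \<noteq> {0} \<Longrightarrow> M \<subseteq> I"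
  using minimal by (auto simp: minimal_ideal_def)

text \<open>In a ring without unit \<open>xR\<close> might be zero for \<open>x \<noteq> 0\<close>; here \<open>R\<^sup>* = 0\<close> excludes this.\<close>

lemma M_subset_multiples:
  assumes "x \<noteq> 0"
  shows "M \<subseteq> range ((*) x)"
proof (rule M_least[OF ring_ideal_multiples])
  have "x \<notin> ideal_ann UNIV"
    using assms by (simp add: ann_UNIV)
  then show "range ((*) x) \<noteq> {0}"
    by (auto simp: ideal_ann_iff)
qed

definition P :: "'a set" where "P = ideal_ann M"

lemma P_ideal: "ring_ideal P"
  unfolding P_def by (rule ring_ideal_ann)

text \<open>If \<open>x \<noteq> 0\<close>, then \<open>M \<subseteq> xR\<close>, so whatever annihilates \<open>x\<close> annihilates \<open>M\<close>.\<close>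

lemma outside_P_regular:
  assumes "s \<notin> P" "s * x = 0"
  shows "x = 0"
proof (rule ccontr)
  assume "x \<noteq> 0"
  then have "s * m = 0" if "m \<in> M" for m
    using M_subset_multiples that assms(2) by (force simp: mult.assoc[symmetric])
  then show False
    using assms(1) by (auto simp: P_def ideal_ann_iff)
qed

text \<open>\<open>R/P\<close> is isomorphic to the simple module \<open>M\<close>, so it has no proper nonzero ideal.\<close>

lemma outside_P_comaximal:
  assumes "s \<notin> P"
  obtains r p where "p \<in> P" "z = s * r + p"
proof -
  obtain m where m: "m \<in> M" "s * m \<noteq> 0"
    using assms by (auto simp: P_def ideal_ann_iff)
  have "z * m \<in> range ((*) (s * m))"
    using M_subset_multiples[OF m(2)] ring_ideal_mult[OF M_ideal m(1)] by blast
  then obtain r where r: "z * m = s * m * r"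
    by blast
  have zm: "(z - s * r) * m = 0"
    using r by (simp add: algebra_simps)
  have "z - s * r \<in> P"
    unfolding P_def ideal_ann_iff
  proof
    fix y assume "y \<in> M"
    then obtain t where "y = m * t"
      using M_subset_multiples[of m] m(2) by fastforce
    then show "(z - s * r) * y = 0"
      using zm by (metis mult.assoc mult_zero_left)
  qed
  then show thesis
    using that[of "z - s * r" r] by simp
qed

section \<open>The series of annihilators of powers of \<open>P\<close>\<close>

text \<open>\<open>A k\<close> is the annihilator of \<open>P\<^sup>k\<close>, obtained by iterating residuals so that no power of
  \<open>P\<close> has to be formed.\<close>

primrec A :: "nat \<Rightarrow> 'a set" where
  "A 0 = {0}"
| "A (Suc k) = P \<rightarrow>\<^sub>i A k"

lemma A_ideal: "ring_ideal (A k)"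
  by (induction k) (auto simp: ring_ideal_zero intro: ring_ideal_residual)

lemma A_SucD: "x \<in> A (Suc k) \<Longrightarrow> p \<in> P \<Longrightarrow> x * p \<in> A k"
  by (auto simp: ideal_residual_def)

lemma A_Suc: "A k \<subseteq> A (Suc k)"
  using ring_ideal_mult'[OF A_ideal, of _ k] by (auto simp: ideal_residual_def)

lemma A_mono: "j \<le> k \<Longrightarrow> A j \<subseteq> A k"
  by (rule lift_Suc_mono_le[of A]) (rule A_Suc)

text \<open>Elements outside \<open>P\<close> are regular not only on \<open>R\<close> but modulo every \<open>A\<^sub>k\<close>; hence a member of
  the series that contains one of them is all of \<open>R\<close>.\<close>

lemma A_saturated:
  assumes "s \<notin> P" "s * x \<in> A k"
  shows "x \<in> A k"
  using assms(2)
proof (induction k arbitrary: x)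
  case 0
  then show ?case
    using outside_P_regular[OF assms(1)] by simp
next
  case (Suc k)
  then have "s * (x * p) \<in> A k" if "p \<in> P" for p
    using A_SucD[OF Suc.prems that] by (simp add: mult.assoc)
  then show ?case
    using Suc.IH by (simp add: ideal_residual_def)
qed

text \<open>Nilpotency of \<open>P\<close>, the heart of the proof. If the union \<open>T\<close> of the series lay in \<open>P\<close>, then
  (BLR-1) would give \<open>T = P \<cdot> T\<close> and \<open>M = T \<cdot> (T \<rightarrow> M)\<close>, so that \<open>M \<subseteq> P \<cdot> M = 0\<close>.\<close>

lemma series_escapes: "\<exists>k. \<not> A k \<subseteq> P"
proof (rule ccontr)
  assume "\<not> (\<exists>k. \<not> A k \<subseteq> P)"
  then have AP: "A k \<subseteq> P" for k
    by blast
  define T where "T = (\<Union>k. A k)"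
  have T_ideal: "ring_ideal T"
    unfolding ring_ideal_def
  proof (intro conjI ballI allI)
    show "0 \<in> T"
      unfolding T_def using ring_ideal_0[OF A_ideal] by blast
  next
    fix x y assume "x \<in> T" "y \<in> T"
    then obtain i j where "x \<in> A i" "y \<in> A j"
      by (auto simp: T_def)
    then have "x \<in> A (max i j)" "y \<in> A (max i j)"
      using A_mono[of i "max i j"] A_mono[of j "max i j"] by auto
    then show "x - y \<in> T"
      unfolding T_def using ring_ideal_diff[OF A_ideal] by blast
  next
    fix r x assume "x \<in> T"
    then show "r * x \<in> T"
      unfolding T_def using ring_ideal_mult[OF A_ideal] by blast
  qed
  have "A (Suc 0) = ideal_ann (ideal_ann M)"
    by (simp add: P_def ideal_ann_def)
  then have "M \<subseteq> A (Suc 0)"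
    using subset_double_ann by metis
  then have "M \<subseteq> T"
    unfolding T_def by blast
  have "M \<subseteq> {0}"
  proof (rule subideal_least[OF M_ideal T_ideal \<open>M \<subseteq> T\<close> ring_ideal_zero])
    fix y z assume "y \<in> T" and z: "z \<in> T \<rightarrow>\<^sub>i M"
    then obtain k where "y \<in> A k"
      by (auto simp: T_def)
    moreover have "A k \<subseteq> ideal_ann {z}"
    proof (rule subideal_least[OF A_ideal P_ideal AP ring_ideal_ann])
      fix p t assume p: "p \<in> P" and "t \<in> P \<rightarrow>\<^sub>i A k"
      then have "t \<in> A (Suc k)"
        by simp
      then have "t \<in> T"
        unfolding T_def by blast
      then have "z * t \<in> M"
        using z by (auto simp: ideal_residual_def)
      then have "p * (z * t) = 0"
        using p by (auto simp: P_def ideal_ann_iff)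
      then show "p * t \<in> ideal_ann {z}"
        by (simp add: ideal_ann_iff mult_ac)
    qed
    ultimately show "y * z \<in> {0}"
      by (auto simp: ideal_ann_iff)
  qed
  then show False
    using M_nonzero ring_ideal_0[OF M_ideal] by blast
qed

lemma series_reaches_UNIV: "\<exists>n. A n = UNIV"
proof -
  obtain n s where s: "s \<in> A n" "s \<notin> P"
    using series_escapes by blast
  have "x \<in> A n" for x
    using A_saturated[OF s(2)] ring_ideal_mult'[OF A_ideal s(1)] by blast
  then show ?thesis
    by blast
qed

section \<open>Every ideal belongs to the series\<close>

text \<open>For \<open>s \<in> K\<close> outside \<open>P\<close>, the inclusion \<open>A\<^sub>k \<subseteq> K\<close> propagates up the series, since
  \<open>A\<^bsub>k+1\<^esub> = A\<^bsub>k+1\<^esub> \<cdot> (sR + P) \<subseteq> sR + A\<^sub>k\<close>.\<close>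

lemma ideal_eq_UNIV:
  fixes K :: "'a set"
  assumes K: "ring_ideal K" "\<not> K \<subseteq> P"
  shows "K = UNIV"
proof -
  obtain s where s: "s \<in> K" "s \<notin> P"
    using K(2) by blast
  have "A k \<subseteq> K" for k
  proof (induction k)
    case 0
    then show ?case
      using ring_ideal_0[OF K(1)] by simp
  next
    case (Suc k)
    show ?case
    proof (rule ideal_least[OF A_ideal K(1)])
      fix y z assume y: "y \<in> A (Suc k)"
      obtain r p where rp: "p \<in> P" "z = s * r + p"
        using outside_P_comaximal[OF s(2)] .
      have "y * p \<in> K"
        using A_SucD[OF y rp(1)] Suc.IH by blast
      moreover have "(y * r) * s \<in> K"
        using ring_ideal_mult[OF K(1) s(1)] .
      ultimately have "(y * r) * s + y * p \<in> K"
        by (intro ring_ideal_add[OF K(1)])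
      then show "y * z \<in> K"
        by (simp add: rp(2) algebra_simps)
    qed
  qed
  then show ?thesis
    using series_reaches_UNIV by blast
qed

lemma ideal_in_series:
  fixes I :: "'a set"
  assumes I: "ring_ideal I"
  shows "\<exists>k. I = A k"
proof -
  define k where "k = (LEAST k. I \<subseteq> A k)"
  have "\<exists>k. I \<subseteq> A k"
    using series_reaches_UNIV by blast
  then have Ik: "I \<subseteq> A k"
    unfolding k_def by (rule LeastI_ex)
  have "A k \<subseteq> I"
  proof (cases k)
    case 0
    then show ?thesis
      using ring_ideal_0[OF I] by simp
  next
    case (Suc i)
    then have "\<not> I \<subseteq> A i"
      using not_less_Least[of i "\<lambda>k. I \<subseteq> A k"] by (simp add: k_def)
    \<comment> \<open>If \<open>A k \<rightarrow> I\<close> were contained in \<open>P\<close>, then \<open>I = A k \<cdot> (A k \<rightarrow> I)\<close> would lie in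
      \<open>A k \<cdot> P \<subseteq> A i\<close>.\<close>
    then have "\<not> A k \<rightarrow>\<^sub>i I \<subseteq> P"
      using subideal_least[OF I A_ideal Ik A_ideal, of i] A_SucD[of _ i] Suc by blast
    then have "A k \<rightarrow>\<^sub>i I = UNIV"
      by (rule ideal_eq_UNIV[OF ring_ideal_residual[OF I]])
    then have "z * y \<in> I" if "y \<in> A k" for y z
      using that by (auto simp: ideal_residual_def)
    then show ?thesis
      by (intro ideal_least[OF A_ideal I]) (simp add: mult.commute)
  qed
  then show ?thesis
    using Ik by blast
qed

lemma ideals_linear:
  fixes I J :: "'a set"
  assumes "ring_ideal I" "ring_ideal J"
  shows "I \<subseteq> J \<or> J \<subseteq> I"
  using ideal_in_series[OF assms(1)] ideal_in_series[OF assms(2)] A_mono nat_le_linear by metis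

lemma finite_ideals: "finite {I :: 'a set. ring_ideal I}"
proof -
  obtain n where n: "A n = UNIV"
    using series_reaches_UNIV by blast
  have "A k \<in> A ` {..n}" for k
  proof (cases "k \<le> n")
    case False
    then have "A k = A n"
      using A_mono[of n k] n by auto
    then show ?thesis
      by auto
  qed auto
  then have "{I. ring_ideal I} \<subseteq> A ` {..n}"
    using ideal_in_series by blast
  then show ?thesis
    by (rule finite_subset) simp
qed

section \<open>Annihilator ideals and dense ideals\<close>

text \<open>Being a double annihilator passes from \<open>J\<close> to \<open>P \<rightarrow> J\<close>, as \<open>P \<rightarrow> J\<^sup>*\<^sup>* = (P \<cdot> J\<^sup>*)\<^sup>*\<close>.\<close>

lemma series_double_ann: "ideal_ann (ideal_ann (A k)) \<subseteq> A k"
proof (induction k)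
  case 0
  have "ideal_ann {0} = (UNIV :: 'a set)"
    by (auto simp: ideal_ann_iff)
  then show ?case
    by (simp add: ann_UNIV)
next
  case (Suc k)
  show ?case
  proof
    fix x assume x: "x \<in> ideal_ann (ideal_ann (A (Suc k)))"
    have "x * p \<in> A k" if p: "p \<in> P" for p
    proof -
      have "(x * p) * q = 0" if q: "q \<in> ideal_ann (A k)" for q
      proof -
        have "(p * q) * y = 0" if "y \<in> A (Suc k)" for y
          using q A_SucD[OF that p] by (auto simp: ideal_ann_iff mult_ac)
        then have "p * q \<in> ideal_ann (A (Suc k))"
          by (simp add: ideal_ann_iff)
        then show ?thesis
          using x by (auto simp: ideal_ann_iff mult.assoc)
      qed
      then show ?thesis
        using Suc.IH by (auto simp: ideal_ann_iff)
    qed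
    then show "x \<in> A (Suc k)"
      by (simp add: ideal_residual_def)
  qed
qed

lemma ideal_double_ann:
  fixes I :: "'a set"
  assumes "ring_ideal I"
  shows "ideal_ann (ideal_ann I) = I"
proof
  show "ideal_ann (ideal_ann I) \<subseteq> I"
    using series_double_ann ideal_in_series[OF assms] by blast
  show "I \<subseteq> ideal_ann (ideal_ann I)"
    by (rule subset_double_ann)
qed

lemma annihilator_ideal_iff: "annihilator_ideal I \<longleftrightarrow> ring_ideal (I :: 'a set)"
  unfolding annihilator_ideal_def using ideal_double_ann ring_ideal_ann by metis

lemma dense_ideal_iff: "dense_ideal I \<longleftrightarrow> I = (UNIV :: 'a set)"
proof
  assume "dense_ideal I"
  then have "I = ideal_ann {0}"
    using ideal_double_ann by (metis dense_ideal_def)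
  then show "I = UNIV"
    by (auto simp: ideal_ann_iff)
next
  assume "I = UNIV"
  then show "dense_ideal I"
    by (simp add: dense_ideal_def ring_ideal_UNIV ann_UNIV)
qed

lemma residual_UNIV:
  fixes I :: "'a set"
  assumes "ring_ideal I"
  shows "UNIV \<rightarrow>\<^sub>i I = I"
proof
  show "UNIV \<rightarrow>\<^sub>i I \<subseteq> I"
    by (rule ideal_least[OF ring_ideal_residual[OF assms] assms]) (simp add: ideal_residual_def)
  show "I \<subseteq> UNIV \<rightarrow>\<^sub>i I"
    using ring_ideal_mult'[OF assms] by (auto simp: ideal_residual_def)
qed

end

theorem proposition4p1:
  fixes M :: "'a::comm_ring set"
  assumes "BL_ring TYPE('a)"
    and "subdirectly_irreducible TYPE('a)"
    and "minimal_ideal M"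
  shows "((\<forall>I J :: 'a set. annihilator_ideal I \<longrightarrow> annihilator_ideal J \<longrightarrow> I \<subseteq> J \<or> J \<subseteq> I)
            \<and> finite {I :: 'a set. annihilator_ideal I})
       \<and> (\<forall>I :: 'a set. ring_ideal I \<longrightarrow> annihilator_ideal I \<or> dense_ideal I)
       \<and> annihilator_ideal M
       \<and> (\<forall>I J :: 'a set. annihilator_ideal I \<longrightarrow> I \<noteq> UNIV \<longrightarrow> dense_ideal J \<longrightarrow>
            I \<subseteq> J \<and> (J \<rightarrow>\<^sub>i I) = I)
       \<and> (\<forall>I J :: 'a set. ring_ideal I \<longrightarrow> ring_ideal J \<longrightarrow>
            dense_ideal (I \<rightarrow>\<^sub>i J) \<or> dense_ideal (J \<rightarrow>\<^sub>i I))"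
proof -
  interpret minimal_ideal_BL M
    using assms(1,3) by unfold_locales (auto simp: BL_ring_def)
  have "I \<rightarrow>\<^sub>i J = UNIV \<or> J \<rightarrow>\<^sub>i I = UNIV" if "ring_ideal I" "ring_ideal J" for I J :: "'a set"
    using ideals_linear[OF that] residual_eq_UNIV that by blast
  then show ?thesis
    by (simp add: annihilator_ideal_iff dense_ideal_iff ideals_linear finite_ideals M_ideal
        residual_UNIV)
qed

end
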